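(* Let $R$ be a ring, let $M_1$ be a semisimple right $R$-module and let $M_2$ be a principally $\delta$-lifting right $R$-module. Assume that $M_1$ and $M_2$ are relatively projective (that is, $M_1$ is $M_2$-projective and $M_2$ is $M_1$-projective). Then $M = M_1\oplus M_2$ is principally $\delta$-lifting.
   Context: Rings have an identity and modules are unital right modules. A submodule $N$ of a module $M$ is $\delta$-small in $M$ if, whenever $M=N+X$ for a submodule $X$ with $M/X$ singular, one has $M=X$. A module $M$ is principally $\delta$-lifting if for each $m\in M$ there is a decomposition $M=A\oplus B$ with $A\leq mR$ and $mR\cap B$ $\delta$-small in $B$. *)

theory Defs
  imports "HOL-Algebra.Module" "HOL-Algebra.AbelCoset" "HOL-Algebra.Ideal"
begin

text \<open>
  Right modules over a not necessarily commutative ring \<open>R\<close> use the record \<^typ>\<open>('a, 'b) module\<close>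
  of HOL-Algebra, where \<open>r \<odot>\<^bsub>M\<^esub> x\<close> stands for the right scalar multiple \<open>x r\<close>; hence the order
  of the scalars in \<open>smult_assoc\<close>. The record fields \<open>mult\<close> and \<open>one\<close> of a module play no role.
  A submodule \<open>N\<close> of \<open>M\<close> is a set with \<open>submodule N R M\<close>; as a module it is
  \<open>M\<lparr>carrier := N\<rparr>\<close>.
\<close>

locale right_module = R?: ring R + M?: abelian_group M
  for R :: "('a, 'r) ring_scheme" (structure) and M :: "('a, 'b, 'm) module_scheme" (structure) +
  assumes smult_closed:
      "\<lbrakk>a \<in> carrier R; x \<in> carrier M\<rbrakk> \<Longrightarrow> a \<odot>\<^bsub>M\<^esub> x \<in> carrier M"
    and smult_l_distr:
      "\<lbrakk>a \<in> carrier R; b \<in> carrier R; x \<in> carrier M\<rbrakk> \<Longrightarrow>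
        (a \<oplus> b) \<odot>\<^bsub>M\<^esub> x = a \<odot>\<^bsub>M\<^esub> x \<oplus>\<^bsub>M\<^esub> b \<odot>\<^bsub>M\<^esub> x"
    and smult_r_distr:
      "\<lbrakk>a \<in> carrier R; x \<in> carrier M; y \<in> carrier M\<rbrakk> \<Longrightarrow>
        a \<odot>\<^bsub>M\<^esub> (x \<oplus>\<^bsub>M\<^esub> y) = a \<odot>\<^bsub>M\<^esub> x \<oplus>\<^bsub>M\<^esub> a \<odot>\<^bsub>M\<^esub> y"
    and smult_assoc:
      "\<lbrakk>a \<in> carrier R; b \<in> carrier R; x \<in> carrier M\<rbrakk> \<Longrightarrow>
        (a \<otimes> b) \<odot>\<^bsub>M\<^esub> x = b \<odot>\<^bsub>M\<^esub> (a \<odot>\<^bsub>M\<^esub> x)"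
    and smult_one:
      "x \<in> carrier M \<Longrightarrow> \<one> \<odot>\<^bsub>M\<^esub> x = x"

definition regular_right_module :: "('a, 'r) ring_scheme \<Rightarrow> ('a, 'a) module" where
  "regular_right_module R =
    \<lparr>carrier = carrier R, monoid.mult = monoid.mult R, one = one R,
     ring.zero = ring.zero R, ring.add = ring.add R, smult = (\<lambda>r x. x \<otimes>\<^bsub>R\<^esub> r)\<rparr>"

definition quotient_module :: "('a, 'b, 'm) module_scheme \<Rightarrow> 'b set \<Rightarrow> ('a, 'b set) module" where
  "quotient_module M K =
    \<lparr>carrier = a_rcosets\<^bsub>M\<^esub> K, monoid.mult = undefined, one = undefined,
     ring.zero = K, ring.add = set_add M, smult = (\<lambda>r C. K <+>\<^bsub>M\<^esub> (\<lambda>x. r \<odot>\<^bsub>M\<^esub> x) ` C)\<rparr>"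

definition direct_sum_module ::
    "('a, 'b, 'm) module_scheme \<Rightarrow> ('a, 'c, 'n) module_scheme \<Rightarrow> ('a, 'b \<times> 'c) module" where
  "direct_sum_module M N =
    \<lparr>carrier = carrier M \<times> carrier N, monoid.mult = undefined, one = undefined,
     ring.zero = (\<zero>\<^bsub>M\<^esub>, \<zero>\<^bsub>N\<^esub>),
     ring.add = (\<lambda>(x, y) (x', y'). (x \<oplus>\<^bsub>M\<^esub> x', y \<oplus>\<^bsub>N\<^esub> y')),
     smult = (\<lambda>r (x, y). (r \<odot>\<^bsub>M\<^esub> x, r \<odot>\<^bsub>N\<^esub> y))\<rparr>"

definition module_homs ::
    "('a, 'r) ring_scheme \<Rightarrow> ('a, 'b, 'm) module_scheme \<Rightarrow> ('a, 'c, 'n) module_scheme \<Rightarrow> ('b \<Rightarrow> 'c) set"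
  where
  "module_homs R M N =
    {h \<in> hom (add_monoid M) (add_monoid N).
      \<forall>r\<in>carrier R. \<forall>x\<in>carrier M. h (r \<odot>\<^bsub>M\<^esub> x) = r \<odot>\<^bsub>N\<^esub> h x}"

definition internal_direct_sum ::
    "('a, 'r) ring_scheme \<Rightarrow> ('a, 'b, 'm) module_scheme \<Rightarrow> 'b set \<Rightarrow> 'b set \<Rightarrow> bool" where
  "internal_direct_sum R M A B \<longleftrightarrow>
    submodule A R M \<and> submodule B R M \<and> A <+>\<^bsub>M\<^esub> B = carrier M \<and> A \<inter> B = {\<zero>\<^bsub>M\<^esub>}"

definition cyclic_submodule ::
    "('a, 'r) ring_scheme \<Rightarrow> ('a, 'b, 'm) module_scheme \<Rightarrow> 'b \<Rightarrow> 'b set" where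
  "cyclic_submodule R M m = (\<lambda>r. r \<odot>\<^bsub>M\<^esub> m) ` carrier R"

definition simple_submodule ::
    "('a, 'r) ring_scheme \<Rightarrow> ('a, 'b, 'm) module_scheme \<Rightarrow> 'b set \<Rightarrow> bool" where
  "simple_submodule R M S \<longleftrightarrow>
    submodule S R M \<and> S \<noteq> {\<zero>\<^bsub>M\<^esub>} \<and>
    (\<forall>N. submodule N R M \<and> N \<subseteq> S \<longrightarrow> N = {\<zero>\<^bsub>M\<^esub>} \<or> N = S)"

definition submodule_span ::
    "('a, 'r) ring_scheme \<Rightarrow> ('a, 'b, 'm) module_scheme \<Rightarrow> 'b set \<Rightarrow> 'b set" where
  "submodule_span R M X = \<Inter>{N. submodule N R M \<and> X \<subseteq> N}"

text \<open>A module is semisimple if it is the sum of its simple submodules.\<close>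

definition semisimple_module ::
    "('a, 'r) ring_scheme \<Rightarrow> ('a, 'b, 'm) module_scheme \<Rightarrow> bool" where
  "semisimple_module R M \<longleftrightarrow> submodule_span R M (\<Union>{S. simple_submodule R M S}) = carrier M"

definition essential_submodule ::
    "('a, 'r) ring_scheme \<Rightarrow> ('a, 'b, 'm) module_scheme \<Rightarrow> 'b set \<Rightarrow> bool" where
  "essential_submodule R M N \<longleftrightarrow>
    submodule N R M \<and> (\<forall>K. submodule K R M \<and> K \<inter> N = {\<zero>\<^bsub>M\<^esub>} \<longrightarrow> K = {\<zero>\<^bsub>M\<^esub>})"

definition annihilator ::
    "('a, 'r) ring_scheme \<Rightarrow> ('a, 'b, 'm) module_scheme \<Rightarrow> 'b \<Rightarrow> 'a set" where
  "annihilator R M x = {r \<in> carrier R. r \<odot>\<^bsub>M\<^esub> x = \<zero>\<^bsub>M\<^esub>}"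

definition singular_module ::
    "('a, 'r) ring_scheme \<Rightarrow> ('a, 'b, 'm) module_scheme \<Rightarrow> bool" where
  "singular_module R M \<longleftrightarrow>
    (\<forall>x\<in>carrier M. essential_submodule R (regular_right_module R) (annihilator R M x))"

definition delta_small ::
    "('a, 'r) ring_scheme \<Rightarrow> ('a, 'b, 'm) module_scheme \<Rightarrow> 'b set \<Rightarrow> bool" where
  "delta_small R M N \<longleftrightarrow>
    submodule N R M \<and>
    (\<forall>X. submodule X R M \<and> carrier M = N <+>\<^bsub>M\<^esub> X \<and> singular_module R (quotient_module M X)
      \<longrightarrow> carrier M = X)"

definition principally_delta_lifting ::
    "('a, 'r) ring_scheme \<Rightarrow> ('a, 'b, 'm) module_scheme \<Rightarrow> bool" where
  "principally_delta_lifting R M \<longleftrightarrow>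
    (\<forall>m\<in>carrier M. \<exists>A B. internal_direct_sum R M A B \<and> A \<subseteq> cyclic_submodule R M m \<and>
      delta_small R (M\<lparr>carrier := B\<rparr>) (cyclic_submodule R M m \<inter> B))"

text \<open>
  \<open>P\<close> is \<open>M\<close>-projective: every homomorphism from \<open>P\<close> to a quotient \<open>M/K\<close> lifts to \<open>M\<close>. Epimorphisms
  from \<open>M\<close> onto arbitrary modules reduce to this case, see \<open>relatively_projective_lift\<close> below.
\<close>

definition relatively_projective ::
    "('a, 'r) ring_scheme \<Rightarrow> ('a, 'b, 'm) module_scheme \<Rightarrow> ('a, 'c, 'n) module_scheme \<Rightarrow> bool" where
  "relatively_projective R P M \<longleftrightarrow>
    (\<forall>K. submodule K R M \<longrightarrow>
      (\<forall>f\<in>module_homs R P (quotient_module M K). \<exists>h\<in>module_homs R P M.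
        \<forall>x\<in>carrier P. K +>\<^bsub>M\<^esub> h x = f x))"

text \<open>The constructions above are right modules.\<close>

lemma regular_right_module:
  assumes "ring R" shows "right_module R (regular_right_module R)"
proof -
  interpret ring R by fact
  have "abelian_group (regular_right_module R)"
  proof (rule abelian_groupI)
    fix x assume "x \<in> carrier (regular_right_module R)"
    then show "\<exists>y\<in>carrier (regular_right_module R).
        y \<oplus>\<^bsub>regular_right_module R\<^esub> x = \<zero>\<^bsub>regular_right_module R\<^esub>"
      by (intro bexI[of _ "\<ominus>\<^bsub>R\<^esub> x"]) (auto simp: regular_right_module_def l_neg)
  qed (auto simp: regular_right_module_def a_ac)
  then show ?thesis
    by (intro right_module.intro assms right_module_axioms.intro)
      (auto simp: regular_right_module_def l_distr r_distr m_assoc)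
qed

lemma direct_sum_right_module:
  assumes "right_module R M" "right_module R N" shows "right_module R (direct_sum_module M N)"
proof -
  interpret M: right_module R M by fact
  interpret N: right_module R N by fact
  have "abelian_group (direct_sum_module M N)"
  proof (rule abelian_groupI)
    fix x assume "x \<in> carrier (direct_sum_module M N)"
    then show "\<exists>y\<in>carrier (direct_sum_module M N).
        y \<oplus>\<^bsub>direct_sum_module M N\<^esub> x = \<zero>\<^bsub>direct_sum_module M N\<^esub>"
      by (intro bexI[of _ "(\<ominus>\<^bsub>M\<^esub> fst x, \<ominus>\<^bsub>N\<^esub> snd x)"])
        (auto simp: direct_sum_module_def M.M.l_neg N.M.l_neg)
  qed (auto simp: direct_sum_module_def M.M.a_ac N.M.a_ac)
  then show ?thesis
    by (intro right_module.intro M.R.ring_axioms right_module_axioms.intro)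
      (auto simp: direct_sum_module_def M.smult_closed N.smult_closed M.smult_l_distr
        N.smult_l_distr M.smult_r_distr N.smult_r_distr M.smult_assoc N.smult_assoc
        M.smult_one N.smult_one)
qed

context right_module
begin

lemma submoduleD:
  assumes "submodule N R M"
  shows "N \<subseteq> carrier M" "\<zero>\<^bsub>M\<^esub> \<in> N"
    "\<And>x y. x \<in> N \<Longrightarrow> y \<in> N \<Longrightarrow> x \<oplus>\<^bsub>M\<^esub> y \<in> N"
    "\<And>x. x \<in> N \<Longrightarrow> \<ominus>\<^bsub>M\<^esub> x \<in> N"
    "\<And>r x. r \<in> carrier R \<Longrightarrow> x \<in> N \<Longrightarrow> r \<odot>\<^bsub>M\<^esub> x \<in> N"
proof -
  interpret N: submodule N R M by fact
  show "N \<subseteq> carrier M" "\<zero>\<^bsub>M\<^esub> \<in> N"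
    "\<And>x y. x \<in> N \<Longrightarrow> y \<in> N \<Longrightarrow> x \<oplus>\<^bsub>M\<^esub> y \<in> N"
    "\<And>x. x \<in> N \<Longrightarrow> \<ominus>\<^bsub>M\<^esub> x \<in> N"
    "\<And>r x. r \<in> carrier R \<Longrightarrow> x \<in> N \<Longrightarrow> r \<odot>\<^bsub>M\<^esub> x \<in> N"
    using N.subset N.one_closed N.m_closed N.m_inv_closed N.smult_closed
    by (auto simp: a_inv_def)
qed

lemma submodule_right_module:
  assumes "submodule N R M" shows "right_module R (M\<lparr>carrier := N\<rparr>)"
proof -
  note N = submoduleD[OF assms]
  have "abelian_group (M\<lparr>carrier := N\<rparr>)"
  proof (rule abelian_groupI)
    fix x assume "x \<in> carrier (M\<lparr>carrier := N\<rparr>)"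
    then show "\<exists>y\<in>carrier (M\<lparr>carrier := N\<rparr>). y \<oplus>\<^bsub>M\<lparr>carrier := N\<rparr>\<^esub> x = \<zero>\<^bsub>M\<lparr>carrier := N\<rparr>\<^esub>"
      using N by (intro bexI[of _ "\<ominus>\<^bsub>M\<^esub> x"]) (auto simp: M.l_neg subset_iff)
  qed (use N in \<open>auto simp: subset_iff M.a_ac\<close>)
  then show ?thesis
    using N by (intro right_module.intro R.ring_axioms right_module_axioms.intro)
      (auto simp: subset_iff smult_l_distr smult_r_distr smult_assoc smult_one)
qed

lemma
  assumes "submodule K R M"
  shows quotient_add: "\<And>x y. x \<in> carrier M \<Longrightarrow> y \<in> carrier M \<Longrightarrow>
      (K +>\<^bsub>M\<^esub> x) <+>\<^bsub>M\<^esub> (K +>\<^bsub>M\<^esub> y) = K +>\<^bsub>M\<^esub> (x \<oplus>\<^bsub>M\<^esub> y)"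
    and quotient_smult: "\<And>r x. r \<in> carrier R \<Longrightarrow> x \<in> carrier M \<Longrightarrow>
      r \<odot>\<^bsub>quotient_module M K\<^esub> (K +>\<^bsub>M\<^esub> x) = K +>\<^bsub>M\<^esub> (r \<odot>\<^bsub>M\<^esub> x)"
    and quotient_eq_iff: "\<And>x y. x \<in> carrier M \<Longrightarrow> y \<in> carrier M \<Longrightarrow>
      K +>\<^bsub>M\<^esub> x = K +>\<^bsub>M\<^esub> y \<longleftrightarrow> x \<ominus>\<^bsub>M\<^esub> y \<in> K"
    and quotient_zero: "K +>\<^bsub>M\<^esub> \<zero>\<^bsub>M\<^esub> = K"
    and quotient_right_module: "right_module R (quotient_module M K)"
proof -
  note K = submoduleD[OF assms]
  have "subgroup K (add_monoid M)" using assms by (simp add: submodule_def)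
  then interpret K: abelian_subgroup K M
    by (intro abelian_subgroupI3 additive_subgroup.intro M.abelian_group_axioms)
  show add: "(K +>\<^bsub>M\<^esub> x) <+>\<^bsub>M\<^esub> (K +>\<^bsub>M\<^esub> y) = K +>\<^bsub>M\<^esub> (x \<oplus>\<^bsub>M\<^esub> y)"
    if "x \<in> carrier M" "y \<in> carrier M" for x y
    using that by (rule K.a_rcos_sum)
  show zero: "K +>\<^bsub>M\<^esub> \<zero>\<^bsub>M\<^esub> = K" using K(1) by (rule M.a_coset_add_zero)
  show sm: "r \<odot>\<^bsub>quotient_module M K\<^esub> (K +>\<^bsub>M\<^esub> x) = K +>\<^bsub>M\<^esub> (r \<odot>\<^bsub>M\<^esub> x)"
    if r: "r \<in> carrier R" and x: "x \<in> carrier M" for r x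
  proof (intro equalityI subsetI)
    fix z assume "z \<in> r \<odot>\<^bsub>quotient_module M K\<^esub> (K +>\<^bsub>M\<^esub> x)"
    then obtain k l where kl: "k \<in> K" "l \<in> K" "z = k \<oplus>\<^bsub>M\<^esub> r \<odot>\<^bsub>M\<^esub> (l \<oplus>\<^bsub>M\<^esub> x)"
      by (auto simp: quotient_module_def set_add_def' a_r_coset_def')
    then have "z = (k \<oplus>\<^bsub>M\<^esub> r \<odot>\<^bsub>M\<^esub> l) \<oplus>\<^bsub>M\<^esub> r \<odot>\<^bsub>M\<^esub> x"
      using K(1) r x by (simp add: subset_iff smult_r_distr smult_closed M.a_assoc)
    moreover have "k \<oplus>\<^bsub>M\<^esub> r \<odot>\<^bsub>M\<^esub> l \<in> K" using kl K(3,5) r by blast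
    ultimately show "z \<in> K +>\<^bsub>M\<^esub> (r \<odot>\<^bsub>M\<^esub> x)" by (auto simp: a_r_coset_def')
  next
    fix z assume "z \<in> K +>\<^bsub>M\<^esub> (r \<odot>\<^bsub>M\<^esub> x)"
    then obtain k where k: "k \<in> K" "z = k \<oplus>\<^bsub>M\<^esub> r \<odot>\<^bsub>M\<^esub> x" by (auto simp: a_r_coset_def')
    then have "z = k \<oplus>\<^bsub>M\<^esub> r \<odot>\<^bsub>M\<^esub> (\<zero>\<^bsub>M\<^esub> \<oplus>\<^bsub>M\<^esub> x)" using x by simp
    then have "\<exists>l\<in>K. z = k \<oplus>\<^bsub>M\<^esub> r \<odot>\<^bsub>M\<^esub> (l \<oplus>\<^bsub>M\<^esub> x)" using K(2) by blast
    with k(1) show "z \<in> r \<odot>\<^bsub>quotient_module M K\<^esub> (K +>\<^bsub>M\<^esub> x)"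
      unfolding quotient_module_def set_add_def' a_r_coset_def' by simp blast
  qed
  show "K +>\<^bsub>M\<^esub> x = K +>\<^bsub>M\<^esub> y \<longleftrightarrow> x \<ominus>\<^bsub>M\<^esub> y \<in> K" if "x \<in> carrier M" "y \<in> carrier M" for x y
    using that K.a_rcos_module[of y x] K.a_rcos_self[of x] K.a_repr_independence'[of x y]
    by (auto simp: a_minus_def)
  have cE: "\<exists>x\<in>carrier M. C = K +>\<^bsub>M\<^esub> x" if "C \<in> carrier (quotient_module M K)" for C
    using that by (auto simp: quotient_module_def A_RCOSETS_def')
  have cI: "K +>\<^bsub>M\<^esub> x \<in> carrier (quotient_module M K)" if "x \<in> carrier M" for x
    using that by (auto simp: quotient_module_def A_RCOSETS_def')
  have qadd: "ring.add (quotient_module M K) = set_add M"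
    and qzero: "ring.zero (quotient_module M K) = K +>\<^bsub>M\<^esub> \<zero>\<^bsub>M\<^esub>"
    by (simp_all add: quotient_module_def zero)
  have "abelian_group (quotient_module M K)"
  proof (rule abelian_groupI)
    fix C assume "C \<in> carrier (quotient_module M K)"
    then obtain x where "x \<in> carrier M" "C = K +>\<^bsub>M\<^esub> x" using cE by blast
    then show "\<exists>D\<in>carrier (quotient_module M K).
        D \<oplus>\<^bsub>quotient_module M K\<^esub> C = \<zero>\<^bsub>quotient_module M K\<^esub>"
      by (intro bexI[of _ "K +>\<^bsub>M\<^esub> (\<ominus>\<^bsub>M\<^esub> x)"]) (auto simp: qadd qzero add M.l_neg intro: cI)
  qed (auto dest!: cE intro!: cI simp: qadd qzero add M.a_ac)
  then show "right_module R (quotient_module M K)"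
    by (intro right_module.intro R.ring_axioms right_module_axioms.intro)
      (auto dest!: cE intro!: cI simp: qadd add sm smult_closed smult_l_distr smult_r_distr
        smult_assoc smult_one)
qed

end

lemma relatively_projective_lift:
  assumes P: "right_module R P" and M: "right_module R M" and N: "right_module R N"
    and proj: "relatively_projective R P M"
    and g: "g \<in> module_homs R M N" "g ` carrier M = carrier N" and f: "f \<in> module_homs R P N"
  shows "\<exists>h\<in>module_homs R P M. \<forall>x\<in>carrier P. g (h x) = f x"
proof -
  interpret P: right_module R P by fact
  interpret M: right_module R M by fact
  interpret N: right_module R N by fact
  interpret g: abelian_group_hom M N g
    using g(1) by (intro abelian_group_homI M.M.abelian_group_axioms N.M.abelian_group_axioms)
      (auto simp: module_homs_def hom_def intro!: group_hom.intro group_hom_axioms.intro)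
  define K where "K = {x \<in> carrier M. g x = \<zero>\<^bsub>N\<^esub>}"
  have gs: "g (r \<odot>\<^bsub>M\<^esub> x) = r \<odot>\<^bsub>N\<^esub> g x" if "r \<in> carrier R" "x \<in> carrier M" for r x
    using g(1) that by (simp add: module_homs_def)
  have s0: "r \<odot>\<^bsub>N\<^esub> \<zero>\<^bsub>N\<^esub> = \<zero>\<^bsub>N\<^esub>" if "r \<in> carrier R" for r
    using N.smult_r_distr[OF that N.M.zero_closed N.M.zero_closed] N.smult_closed[OF that]
    by (metis N.M.add.l_cancel_one' N.M.l_zero N.M.zero_closed)
  have "subgroup K (add_monoid M)"
    by (rule M.M.add.subgroupI) (auto simp: K_def simp flip: a_inv_def)
  then have K: "submodule K R M"
    by (intro submodule.intro submodule_axioms.intro)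
      (auto simp: K_def M.smult_closed gs s0)
  define s where "s y = (SOME x. x \<in> carrier M \<and> g x = y)" for y
  have s: "s y \<in> carrier M" "g (s y) = y" if "y \<in> carrier N" for y
  proof -
    have "\<exists>x. x \<in> carrier M \<and> g x = y" using that unfolding g(2)[symmetric] by auto
    then have "s y \<in> carrier M \<and> g (s y) = y" unfolding s_def by (rule someI_ex)
    then show "s y \<in> carrier M" "g (s y) = y" by auto
  qed
  have ker: "K +>\<^bsub>M\<^esub> x = K +>\<^bsub>M\<^esub> y \<longleftrightarrow> g x = g y" if "x \<in> carrier M" "y \<in> carrier M" for x y
  proof -
    have "g (x \<ominus>\<^bsub>M\<^esub> y) = g x \<ominus>\<^bsub>N\<^esub> g y" using that by (simp add: a_minus_def)
    then have "x \<ominus>\<^bsub>M\<^esub> y \<in> K \<longleftrightarrow> g x = g y"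
      using that N.M.minus_equality[of "g x" "\<ominus>\<^bsub>N\<^esub> g y"] N.M.r_neg[of "g y"]
      by (auto simp: K_def a_minus_def)
    then show ?thesis unfolding M.quotient_eq_iff[OF K that] .
  qed
  have fP: "f x \<in> carrier N" if "x \<in> carrier P" for x
    using f that by (auto simp: module_homs_def hom_def)
  define f' where "f' x = K +>\<^bsub>M\<^esub> s (f x)" for x
  have "f' \<in> module_homs R P (quotient_module M K)"
    unfolding module_homs_def hom_def
  proof (intro CollectI conjI ballI Pi_I)
    fix x assume x: "x \<in> carrier (add_monoid P)"
    then show "f' x \<in> carrier (add_monoid (quotient_module M K))"
      using s(1) fP by (auto simp: f'_def quotient_module_def A_RCOSETS_def')
    fix y assume y: "y \<in> carrier (add_monoid P)"
    have "f (x \<oplus>\<^bsub>P\<^esub> y) = f x \<oplus>\<^bsub>N\<^esub> f y" using f x y by (auto simp: module_homs_def hom_def)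
    then show "f' (x \<otimes>\<^bsub>add_monoid P\<^esub> y) = f' x \<otimes>\<^bsub>add_monoid (quotient_module M K)\<^esub> f' y"
      using x y s fP by (simp add: f'_def quotient_module_def M.quotient_add[OF K] ker)
  next
    fix r x assume r: "r \<in> carrier R" and x: "x \<in> carrier P"
    have "f (r \<odot>\<^bsub>P\<^esub> x) = r \<odot>\<^bsub>N\<^esub> f x" using f r x by (auto simp: module_homs_def)
    then show "f' (r \<odot>\<^bsub>P\<^esub> x) = r \<odot>\<^bsub>quotient_module M K\<^esub> f' x"
      using r x s fP
      by (simp add: f'_def M.quotient_smult[OF K] ker M.smult_closed N.smult_closed gs)
  qed
  then obtain h where h: "h \<in> module_homs R P M" "\<forall>x\<in>carrier P. K +>\<^bsub>M\<^esub> h x = f' x"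
    using proj K unfolding relatively_projective_def by blast
  have "g (h x) = f x" if x: "x \<in> carrier P" for x
  proof -
    have "h x \<in> carrier M" using h(1) x by (auto simp: module_homs_def hom_def)
    then show ?thesis using h(2) x s fP ker by (auto simp: f'_def)
  qed
  with h(1) show ?thesis by blast
qed

end

theory Submission
  imports Defs
begin

text \<open>
  Let \<open>m = (m\<^sub>1, m\<^sub>2)\<close> and write \<open>M\<^sub>1 = m\<^sub>1 R \<oplus> K'\<close> by semisimplicity. Since \<open>M\<^sub>1\<close> is
  \<open>M\<^sub>2\<close>-projective, there is a homomorphism \<open>h\<close> from \<open>M\<^sub>1\<close> to \<open>M\<^sub>2\<close> such that \<open>m R\<close> contains the
  graph of \<open>h\<close> over \<open>m\<^sub>1 R\<close>; then \<open>m R\<close> is the direct sum of that graph and \<open>0 \<times> n R\<close>, where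
  \<open>n = m\<^sub>2 - h m\<^sub>1\<close>. For a decomposition \<open>M\<^sub>2 = A \<oplus> B\<close> belonging to \<open>n\<close>, the sum of the graph and
  \<open>0 \<times> A\<close> lies in \<open>m R\<close> and has the complement \<open>K' \<times> B\<close>, which meets \<open>m R\<close> in
  \<open>0 \<times> (n R \<inter> B)\<close>. This is \<open>\<delta>\<close>-small as a homomorphic image of a \<open>\<delta>\<close>-small submodule.
\<close>

section \<open>Elementary facts on right modules and submodules\<close>

context right_module
begin

lemma smult_zero_right:
  assumes "r \<in> carrier R" shows "r \<odot>\<^bsub>M\<^esub> \<zero>\<^bsub>M\<^esub> = \<zero>\<^bsub>M\<^esub>"
  using smult_r_distr[OF assms M.zero_closed M.zero_closed] smult_closed[OF assms M.zero_closed]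
  by (metis M.add.l_cancel_one' M.l_zero M.zero_closed)

lemma smult_zero_left:
  assumes "x \<in> carrier M" shows "\<zero> \<odot>\<^bsub>M\<^esub> x = \<zero>\<^bsub>M\<^esub>"
  using smult_l_distr[OF R.zero_closed R.zero_closed assms] smult_closed[OF R.zero_closed assms]
  by (metis M.add.l_cancel_one' R.l_zero R.zero_closed)

lemma smult_minus_left:
  assumes "r \<in> carrier R" "x \<in> carrier M" shows "(\<ominus> r) \<odot>\<^bsub>M\<^esub> x = \<ominus>\<^bsub>M\<^esub> (r \<odot>\<^bsub>M\<^esub> x)"
proof -
  have "(\<ominus> r) \<odot>\<^bsub>M\<^esub> x \<oplus>\<^bsub>M\<^esub> r \<odot>\<^bsub>M\<^esub> x = \<zero>\<^bsub>M\<^esub>"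
    using assms by (simp add: R.l_neg smult_zero_left flip: smult_l_distr)
  then show ?thesis using assms by (simp add: M.minus_equality smult_closed)
qed

lemma smult_minus_right:
  assumes "r \<in> carrier R" "x \<in> carrier M" shows "r \<odot>\<^bsub>M\<^esub> (\<ominus>\<^bsub>M\<^esub> x) = \<ominus>\<^bsub>M\<^esub> (r \<odot>\<^bsub>M\<^esub> x)"
proof -
  have "r \<odot>\<^bsub>M\<^esub> (\<ominus>\<^bsub>M\<^esub> x) \<oplus>\<^bsub>M\<^esub> r \<odot>\<^bsub>M\<^esub> x = \<zero>\<^bsub>M\<^esub>"
    using assms by (simp add: M.l_neg smult_zero_right flip: smult_r_distr)
  then show ?thesis using assms by (simp add: M.minus_equality smult_closed)
qed

text \<open>Negatives are obtained by scaling with \<open>\<ominus> \<one>\<close>, so the subgroup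
  property follows from closure under sums and scalars.\<close>

lemma submoduleI:
  assumes "N \<subseteq> carrier M" "\<zero>\<^bsub>M\<^esub> \<in> N"
    and "\<And>x y. x \<in> N \<Longrightarrow> y \<in> N \<Longrightarrow> x \<oplus>\<^bsub>M\<^esub> y \<in> N"
    and "\<And>r x. r \<in> carrier R \<Longrightarrow> x \<in> N \<Longrightarrow> r \<odot>\<^bsub>M\<^esub> x \<in> N"
  shows "submodule N R M"
proof -
  have "\<ominus>\<^bsub>M\<^esub> x \<in> N" if "x \<in> N" for x
    using assms(4)[of "\<ominus> \<one>" x] smult_minus_left[of \<one> x] that assms(1)
    by (auto simp: smult_one subset_iff)
  then have "subgroup N (add_monoid M)"
    using assms by (intro M.add.subgroupI) (auto simp flip: a_inv_def)
  then show ?thesis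
    using assms(4) by (intro submodule.intro submodule_axioms.intro)
qed

lemma submodule_zero: "submodule {\<zero>\<^bsub>M\<^esub>} R M"
  by (rule submoduleI) (auto simp: smult_zero_right)

lemma submodule_Int:
  assumes "submodule A R M" "submodule B R M" shows "submodule (A \<inter> B) R M"
  by (rule submoduleI) (use submoduleD[OF assms(1)] submoduleD[OF assms(2)] in auto)

lemma mem_set_add: "z \<in> A <+>\<^bsub>M\<^esub> B \<longleftrightarrow> (\<exists>a\<in>A. \<exists>b\<in>B. z = a \<oplus>\<^bsub>M\<^esub> b)"
  by (auto simp: set_add_def')

lemma submodule_sum:
  assumes "submodule A R M" "submodule B R M" shows "submodule (A <+>\<^bsub>M\<^esub> B) R M"
proof (rule submoduleI)
  note A = submoduleD[OF assms(1)] and B = submoduleD[OF assms(2)]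
  show "A <+>\<^bsub>M\<^esub> B \<subseteq> carrier M" using A(1) B(1) by (auto simp: mem_set_add subset_iff)
  show "\<zero>\<^bsub>M\<^esub> \<in> A <+>\<^bsub>M\<^esub> B" unfolding mem_set_add using A(2) B(2) by force
  fix x assume "x \<in> A <+>\<^bsub>M\<^esub> B"
  then obtain a b where ab: "a \<in> A" "b \<in> B" "x = a \<oplus>\<^bsub>M\<^esub> b" by (auto simp: mem_set_add)
  then have abc: "a \<in> carrier M" "b \<in> carrier M" using A(1) B(1) by auto
  show "r \<odot>\<^bsub>M\<^esub> x \<in> A <+>\<^bsub>M\<^esub> B" if "r \<in> carrier R" for r
    unfolding mem_set_add ab(3) smult_r_distr[OF that abc] using A(5) B(5) ab that by blast
  fix y assume "y \<in> A <+>\<^bsub>M\<^esub> B"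
  then obtain a' b' where ab': "a' \<in> A" "b' \<in> B" "y = a' \<oplus>\<^bsub>M\<^esub> b'" by (auto simp: mem_set_add)
  then have "a' \<in> carrier M" "b' \<in> carrier M" using A(1) B(1) by auto
  then have "x \<oplus>\<^bsub>M\<^esub> y = (a \<oplus>\<^bsub>M\<^esub> a') \<oplus>\<^bsub>M\<^esub> (b \<oplus>\<^bsub>M\<^esub> b')"
    using abc ab(3) ab'(3) by (simp add: M.a_ac)
  then show "x \<oplus>\<^bsub>M\<^esub> y \<in> A <+>\<^bsub>M\<^esub> B" unfolding mem_set_add using A(3) B(3) ab ab' by blast
qed

lemma subset_set_add:
  assumes "submodule A R M" "submodule B R M"
  shows "A \<subseteq> A <+>\<^bsub>M\<^esub> B" "B \<subseteq> A <+>\<^bsub>M\<^esub> B"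
proof -
  note A = submoduleD[OF assms(1)] and B = submoduleD[OF assms(2)]
  show "A \<subseteq> A <+>\<^bsub>M\<^esub> B"
  proof
    fix a assume "a \<in> A"
    then show "a \<in> A <+>\<^bsub>M\<^esub> B"
      unfolding mem_set_add using A(1) B(2) by (intro bexI[of _ a] bexI[of _ "\<zero>\<^bsub>M\<^esub>"]) auto
  qed
  show "B \<subseteq> A <+>\<^bsub>M\<^esub> B"
  proof
    fix b assume "b \<in> B"
    then show "b \<in> A <+>\<^bsub>M\<^esub> B"
      unfolding mem_set_add using B(1) A(2) by (intro bexI[of _ b] bexI[of _ "\<zero>\<^bsub>M\<^esub>"]) auto
  qed
qed

text \<open>Two elements of the union already lie in a common member of the chain. This supplies the
  upper bounds for Zorn's lemma in the construction of complements.\<close>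

lemma submodule_Union_chain:
  assumes "\<C> \<noteq> {}" "\<And>N. N \<in> \<C> \<Longrightarrow> submodule N R M"
    and "\<And>N N'. N \<in> \<C> \<Longrightarrow> N' \<in> \<C> \<Longrightarrow> N \<subseteq> N' \<or> N' \<subseteq> N"
  shows "submodule (\<Union>\<C>) R M"
proof (rule submoduleI)
  show "\<Union>\<C> \<subseteq> carrier M" using submoduleD(1)[OF assms(2)] by blast
  show "\<zero>\<^bsub>M\<^esub> \<in> \<Union>\<C>" using assms(1) submoduleD(2)[OF assms(2)] by blast
  show "r \<odot>\<^bsub>M\<^esub> x \<in> \<Union>\<C>" if "r \<in> carrier R" "x \<in> \<Union>\<C>" for r x
    using submoduleD(5)[OF assms(2)] that by blast
  fix x y assume "x \<in> \<Union>\<C>" "y \<in> \<Union>\<C>"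
  then obtain N N' where "N \<in> \<C>" "x \<in> N" "N' \<in> \<C>" "y \<in> N'" by blast
  with assms(3)[of N N'] obtain N'' where "N'' \<in> \<C>" "x \<in> N''" "y \<in> N''" by blast
  then show "x \<oplus>\<^bsub>M\<^esub> y \<in> \<Union>\<C>" using submoduleD(3)[OF assms(2)] by blast
qed

lemma submodule_cyclic:
  assumes m: "m \<in> carrier M" shows "submodule (cyclic_submodule R M m) R M"
proof (rule submoduleI)
  show "cyclic_submodule R M m \<subseteq> carrier M" using m by (auto simp: cyclic_submodule_def smult_closed)
  show "\<zero>\<^bsub>M\<^esub> \<in> cyclic_submodule R M m"
    unfolding cyclic_submodule_def using smult_zero_left[OF m] by (metis imageI R.zero_closed)
  fix x assume "x \<in> cyclic_submodule R M m"
  then obtain r where r: "r \<in> carrier R" "x = r \<odot>\<^bsub>M\<^esub> m" by (auto simp: cyclic_submodule_def)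
  show "s \<odot>\<^bsub>M\<^esub> x \<in> cyclic_submodule R M m" if "s \<in> carrier R" for s
    using smult_assoc[OF r(1) that m] r that unfolding cyclic_submodule_def
    by (metis imageI R.m_closed)
  fix y assume "y \<in> cyclic_submodule R M m"
  then obtain s where s: "s \<in> carrier R" "y = s \<odot>\<^bsub>M\<^esub> m" by (auto simp: cyclic_submodule_def)
  show "x \<oplus>\<^bsub>M\<^esub> y \<in> cyclic_submodule R M m"
    using smult_l_distr[OF r(1) s(1) m] r s unfolding cyclic_submodule_def
    by (metis imageI R.a_closed)
qed

section \<open>Complements in semisimple modules\<close>

text \<open>Zorn's lemma gives \<open>N\<close> maximal among the submodules meeting
  \<open>K\<close> trivially. A simple submodule \<open>S\<close> outside \<open>K + N\<close> could
  be added to \<open>N\<close> without meeting \<open>K\<close>, against maximality. Hence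
  \<open>K + N\<close> contains every simple submodule, and these span the module.\<close>

lemma semisimple_complement:
  assumes ss: "semisimple_module R M" and K: "submodule K R M"
  obtains N where "internal_direct_sum R M K N"
proof -
  define \<A> where "\<A> = {N. submodule N R M \<and> K \<inter> N = {\<zero>\<^bsub>M\<^esub>}}"
  have "\<exists>N\<in>\<A>. \<forall>N'\<in>\<A>. N \<subseteq> N' \<longrightarrow> N' = N"
  proof (rule subset_Zorn_nonempty)
    show "\<A> \<noteq> {}" using submodule_zero submoduleD(2)[OF K] by (auto simp: \<A>_def)
    fix \<C> assume C: "\<C> \<noteq> {}" "subset.chain \<A> \<C>"
    then have sub: "N \<in> \<A>" if "N \<in> \<C>" for N using that by (auto simp: subset.chain_def)
    have "submodule (\<Union>\<C>) R M"
      using C(1) sub subset.chain_total[OF C(2)] by (intro submodule_Union_chain) (auto simp: \<A>_def)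
    moreover have "K \<inter> \<Union>\<C> = {\<zero>\<^bsub>M\<^esub>}" using C(1) sub by (auto simp: \<A>_def)
    ultimately show "\<Union>\<C> \<in> \<A>" by (simp add: \<A>_def)
  qed
  then obtain N where N: "submodule N R M" "K \<inter> N = {\<zero>\<^bsub>M\<^esub>}"
    and max: "\<And>N'. submodule N' R M \<Longrightarrow> K \<inter> N' = {\<zero>\<^bsub>M\<^esub>} \<Longrightarrow> N \<subseteq> N' \<Longrightarrow> N' = N"
    by (auto simp: \<A>_def)
  note KD = submoduleD[OF K] and ND = submoduleD[OF N(1)]
  note KN = submodule_sum[OF K N(1)]
  have "S \<subseteq> K <+>\<^bsub>M\<^esub> N" if S: "simple_submodule R M S" for S
  proof (rule ccontr)
    assume nsub: "\<not> S \<subseteq> K <+>\<^bsub>M\<^esub> N"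
    have Ss: "submodule S R M" using S by (simp add: simple_submodule_def)
    note SD = submoduleD[OF Ss]
    \<comment> \<open>The intersection is a submodule of the simple \<open>S\<close>, so it is zero
      or \<open>S\<close>; the second case contradicts \<open>nsub\<close>.\<close>
    have int: "S \<inter> (K <+>\<^bsub>M\<^esub> N) = {\<zero>\<^bsub>M\<^esub>}"
      using S submodule_Int[OF Ss KN] nsub unfolding simple_submodule_def by blast
    \<comment> \<open>This is \<open>K \<inter> (N + S) = 0\<close>: from
      \<open>s = (n + s) - n\<close> one gets \<open>s \<in> K + N\<close>, so \<open>s = 0\<close>
      by \<open>int\<close>, and then \<open>n\<close> lies in \<open>K \<inter> N\<close>.\<close>
    have "n \<oplus>\<^bsub>M\<^esub> s = \<zero>\<^bsub>M\<^esub>" if "n \<in> N" "s \<in> S" "n \<oplus>\<^bsub>M\<^esub> s \<in> K" for n s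
    proof -
      have "n \<in> carrier M" "s \<in> carrier M" using that ND(1) SD(1) by auto
      then have "s = (s \<oplus>\<^bsub>M\<^esub> n) \<oplus>\<^bsub>M\<^esub> (\<ominus>\<^bsub>M\<^esub> n)" "s \<oplus>\<^bsub>M\<^esub> n = n \<oplus>\<^bsub>M\<^esub> s"
        by (simp add: M.a_assoc M.r_neg, intro M.a_comm)
      then have "s \<in> K <+>\<^bsub>M\<^esub> N"
        unfolding mem_set_add using that(1,3) ND(4)
        by (intro bexI[of _ "n \<oplus>\<^bsub>M\<^esub> s"] bexI[of _ "\<ominus>\<^bsub>M\<^esub> n"]) auto
      then have "s = \<zero>\<^bsub>M\<^esub>" using that(2) int by blast
      moreover from this have "n \<in> K \<inter> N" using that(1,3) ND(1) by auto
      ultimately show ?thesis using N(2) by simp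
    qed
    then have "K \<inter> (N <+>\<^bsub>M\<^esub> S) \<subseteq> {\<zero>\<^bsub>M\<^esub>}" by (auto simp: mem_set_add)
    then have "K \<inter> (N <+>\<^bsub>M\<^esub> S) = {\<zero>\<^bsub>M\<^esub>}"
      using KD(2) submoduleD(2)[OF submodule_sum[OF N(1) Ss]] by blast
    then have "N <+>\<^bsub>M\<^esub> S = N"
      using max submodule_sum[OF N(1) Ss] subset_set_add[OF N(1) Ss] by blast
    then show False
      using nsub subset_set_add[OF N(1) Ss] subset_set_add[OF K N(1)] by blast
  qed
  \<comment> \<open>\<open>K + N\<close> is one of the submodules whose intersection is the
    span.\<close>
  then have "submodule_span R M (\<Union>{S. simple_submodule R M S}) \<subseteq> K <+>\<^bsub>M\<^esub> N"
    using KN unfolding submodule_span_def by blast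
  then have "K <+>\<^bsub>M\<^esub> N = carrier M"
    using ss submoduleD(1)[OF KN] by (auto simp: semisimple_module_def)
  then show thesis using that K N by (simp add: internal_direct_sum_def)
qed

section \<open>Singular quotients and images of \<delta>-small submodules\<close>

text \<open>The set on the right is the annihilator of the coset \<open>K + x\<close>. Describing it
  by membership in \<open>K\<close> removes the cosets, so that singularity can be compared along a
  homomorphism.\<close>

lemma singular_quotient_iff:
  assumes K: "submodule K R M"
  shows "singular_module R (quotient_module M K) \<longleftrightarrow>
    (\<forall>x\<in>carrier M. essential_submodule R (regular_right_module R) {r \<in> carrier R. r \<odot>\<^bsub>M\<^esub> x \<in> K})"
proof -
  have "annihilator R (quotient_module M K) (K +>\<^bsub>M\<^esub> x) = {r \<in> carrier R. r \<odot>\<^bsub>M\<^esub> x \<in> K}"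
    if x: "x \<in> carrier M" for x
  proof -
    have "K +>\<^bsub>M\<^esub> (r \<odot>\<^bsub>M\<^esub> x) = K \<longleftrightarrow> r \<odot>\<^bsub>M\<^esub> x \<in> K" if "r \<in> carrier R" for r
      using quotient_eq_iff[OF K smult_closed[OF that x] M.zero_closed] smult_closed[OF that x]
      M.minus_equality[of "\<zero>\<^bsub>M\<^esub>" "\<zero>\<^bsub>M\<^esub>"]
      by (simp add: quotient_zero[OF K] a_minus_def)
    moreover have "\<zero>\<^bsub>quotient_module M K\<^esub> = K" by (simp add: quotient_module_def)
    ultimately show ?thesis
      unfolding annihilator_def by (intro Collect_cong conj_cong refl) (simp add: quotient_smult[OF K _ x])
  qed
  moreover have "carrier (quotient_module M K) = (\<lambda>x. K +>\<^bsub>M\<^esub> x) ` carrier M"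
    by (auto simp: quotient_module_def A_RCOSETS_def')
  ultimately show ?thesis by (simp add: singular_module_def)
qed

end

text \<open>A submodule \<open>X\<close> testing \<open>g S\<close> in \<open>N\<close> is pulled
  back to its preimage \<open>Y\<close>, which tests \<open>S\<close> in \<open>M\<close>. Smallness
  of \<open>S\<close> forces \<open>Y\<close> to be all of \<open>M\<close>, so
  \<open>g S \<subseteq> X\<close> and therefore \<open>N = g S + X = X\<close>.\<close>

lemma delta_small_image:
  assumes M: "right_module R M" and N: "right_module R N"
    and g: "g \<in> module_homs R M N" and S: "delta_small R M S"
  shows "delta_small R N (g ` S)"
proof -
  interpret M: right_module R M by fact
  interpret N: right_module R N by fact
  have gc: "g x \<in> carrier N" if "x \<in> carrier M" for x
    using g that by (auto simp: module_homs_def hom_def)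
  have ga: "g (x \<oplus>\<^bsub>M\<^esub> y) = g x \<oplus>\<^bsub>N\<^esub> g y" if "x \<in> carrier M" "y \<in> carrier M" for x y
    using g that by (auto simp: module_homs_def hom_def)
  have gs: "g (r \<odot>\<^bsub>M\<^esub> x) = r \<odot>\<^bsub>N\<^esub> g x" if "r \<in> carrier R" "x \<in> carrier M" for r x
    using g that by (auto simp: module_homs_def)
  have g0: "g \<zero>\<^bsub>M\<^esub> = \<zero>\<^bsub>N\<^esub>"
    using gs[of "\<zero>\<^bsub>R\<^esub>" "\<zero>\<^bsub>M\<^esub>"] gc by (simp add: M.smult_zero_left N.smult_zero_left)
  have Ssub: "submodule S R M" using S by (simp add: delta_small_def)
  note SD = M.submoduleD[OF Ssub]
  have gS: "submodule (g ` S) R N"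
  proof (rule N.submoduleI)
    show "g ` S \<subseteq> carrier N" using SD(1) gc by auto
    show "\<zero>\<^bsub>N\<^esub> \<in> g ` S" using SD(2) g0 by force
    show "x \<oplus>\<^bsub>N\<^esub> y \<in> g ` S" if xy: "x \<in> g ` S" "y \<in> g ` S" for x y
    proof -
      obtain a b where "a \<in> S" "b \<in> S" "x = g a" "y = g b" using xy by blast
      then show ?thesis using ga[of a b] SD(1,3) by (metis imageI subsetD)
    qed
    show "r \<odot>\<^bsub>N\<^esub> x \<in> g ` S" if rx: "r \<in> carrier R" "x \<in> g ` S" for r x
    proof -
      obtain a where "a \<in> S" "x = g a" using rx by blast
      then show ?thesis using gs[of r a] rx(1) SD(1,5) by (metis imageI subsetD)
    qed
  qed
  have "carrier N = X"
    if X: "submodule X R N" "carrier N = g ` S <+>\<^bsub>N\<^esub> X" "singular_module R (quotient_module N X)" for X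
  proof -
    note XD = N.submoduleD[OF X(1)]
    define Y where "Y = {y \<in> carrier M. g y \<in> X}"
    have Y: "submodule Y R M"
      by (rule M.submoduleI) (use XD in \<open>auto simp: Y_def g0 ga gs M.smult_closed\<close>)
    \<comment> \<open>The annihilator of \<open>y\<close> modulo \<open>Y\<close> equals that of
      \<open>g y\<close> modulo \<open>X\<close>, so singularity passes from \<open>N/X\<close> to
      \<open>M/Y\<close>.\<close>
    have "{r \<in> carrier R. r \<odot>\<^bsub>M\<^esub> y \<in> Y} = {r \<in> carrier R. r \<odot>\<^bsub>N\<^esub> g y \<in> X}"
      if "y \<in> carrier M" for y
      using that by (auto simp: Y_def gs M.smult_closed)
    then have "singular_module R (quotient_module M Y)"
      using X(3) gc by (simp add: M.singular_quotient_iff[OF Y] N.singular_quotient_iff[OF X(1)])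
    \<comment> \<open>Split \<open>g y = g s + x\<close> in \<open>N\<close>; then
      \<open>z = y - s\<close> satisfies \<open>g z = x \<in> X\<close>, hence
      \<open>z \<in> Y\<close>.\<close>
    moreover have "carrier M \<subseteq> S <+>\<^bsub>M\<^esub> Y"
    proof
      fix y assume y: "y \<in> carrier M"
      then obtain s x where sx: "s \<in> S" "x \<in> X" "g y = g s \<oplus>\<^bsub>N\<^esub> x"
        using gc X(2) by (fastforce simp: N.mem_set_add)
      define z where "z = \<ominus>\<^bsub>M\<^esub> s \<oplus>\<^bsub>M\<^esub> y"
      have c: "s \<in> carrier M" "x \<in> carrier N" "z \<in> carrier M"
        using sx SD(1) XD(1) y by (auto simp: z_def)
      have yz: "y = s \<oplus>\<^bsub>M\<^esub> z" using c y by (simp add: z_def M.M.r_neg2)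
      then have "g s \<oplus>\<^bsub>N\<^esub> g z = g s \<oplus>\<^bsub>N\<^esub> x" using ga sx(3) c by simp
      then have "g z = x" using c gc by simp
      then have "z \<in> Y" using sx c by (simp add: Y_def)
      then show "y \<in> S <+>\<^bsub>M\<^esub> Y" using yz sx(1) by (auto simp: M.mem_set_add)
    qed
    then have "carrier M = S <+>\<^bsub>M\<^esub> Y"
      using M.submoduleD(1)[OF M.submodule_sum[OF Ssub Y]] by blast
    ultimately have "carrier M = Y" using S Y by (auto simp: delta_small_def)
    then have "g ` S \<subseteq> X" using SD(1) by (auto simp: Y_def)
    then have "g ` S <+>\<^bsub>N\<^esub> X \<subseteq> X" using XD(3) by (auto simp: N.mem_set_add image_subset_iff)
    then show ?thesis using X(2) XD(1) by blast
  qed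
  then show ?thesis using gS by (auto simp: delta_small_def)
qed

section \<open>Relative projectivity applied to a cyclic direct summand\<close>

text \<open>
  The map \<open>h\<close> lifts \<open>p r + q \<mapsto> m r + L\<close> to \<open>M\<close>, where \<open>L = {m r | p r = 0}\<close>; then
  \<open>h p - m\<close> lies in \<open>L\<close>.
\<close>

lemma relatively_projective_cyclic_graph:
  assumes P: "right_module R P" and M: "right_module R M"
    and proj: "relatively_projective R P M"
    and p: "p \<in> carrier P" and m: "m \<in> carrier M"
    and sum: "internal_direct_sum R P (cyclic_submodule R P p) Q"
  obtains h r where "h \<in> module_homs R P M" "r \<in> carrier R"
    "r \<odot>\<^bsub>P\<^esub> p = p" "r \<odot>\<^bsub>M\<^esub> m = h p"
proof -
  interpret P: right_module R P by fact
  interpret M: right_module R M by fact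
  have Q: "submodule Q R P" and PQ: "cyclic_submodule R P p <+>\<^bsub>P\<^esub> Q = carrier P"
    and disj: "cyclic_submodule R P p \<inter> Q = {\<zero>\<^bsub>P\<^esub>}"
    using sum by (auto simp: internal_direct_sum_def)
  note QD = P.submoduleD[OF Q]
  define L where "L = (\<lambda>r. r \<odot>\<^bsub>M\<^esub> m) ` annihilator R P p"
  have LI: "r \<odot>\<^bsub>M\<^esub> m \<in> L" if "r \<in> carrier R" "r \<odot>\<^bsub>P\<^esub> p = \<zero>\<^bsub>P\<^esub>" for r
    using that by (auto simp: L_def annihilator_def)
  have LE: "\<exists>r\<in>carrier R. r \<odot>\<^bsub>P\<^esub> p = \<zero>\<^bsub>P\<^esub> \<and> x = r \<odot>\<^bsub>M\<^esub> m" if "x \<in> L" for x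
    using that by (auto simp: L_def annihilator_def)
  have L: "submodule L R M"
  proof (rule M.submoduleI)
    show "L \<subseteq> carrier M" using LE m M.smult_closed by blast
    show "\<zero>\<^bsub>M\<^esub> \<in> L" using LI[of "\<zero>\<^bsub>R\<^esub>"] m p by (simp add: M.smult_zero_left P.smult_zero_left)
    fix x assume "x \<in> L"
    then obtain r where r: "r \<in> carrier R" "r \<odot>\<^bsub>P\<^esub> p = \<zero>\<^bsub>P\<^esub>" "x = r \<odot>\<^bsub>M\<^esub> m" using LE by blast
    \<comment> \<open>As \<open>p (r s) = (p r) s = 0\<close>, the annihilator of \<open>p\<close>
      is closed under right multiplication.\<close>
    show "s \<odot>\<^bsub>M\<^esub> x \<in> L" if s: "s \<in> carrier R" for s
      using LI[of "r \<otimes>\<^bsub>R\<^esub> s"] r s m p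
      by (simp add: M.smult_assoc P.smult_assoc P.smult_zero_right)
    fix y assume "y \<in> L"
    then obtain s where s: "s \<in> carrier R" "s \<odot>\<^bsub>P\<^esub> p = \<zero>\<^bsub>P\<^esub>" "y = s \<odot>\<^bsub>M\<^esub> m" using LE by blast
    show "x \<oplus>\<^bsub>M\<^esub> y \<in> L"
      using LI[of "r \<oplus>\<^bsub>R\<^esub> s"] r s m p by (simp add: M.smult_l_distr P.smult_l_distr)
  qed
  \<comment> \<open>\<open>rep x r\<close> says that \<open>x \<in> p r + Q\<close>. It is a
    relation, because \<open>r\<close> is determined by \<open>x\<close> only up to the annihilator
    of \<open>p\<close>.\<close>
  define rep where "rep x r \<longleftrightarrow> r \<in> carrier R \<and> (\<exists>q\<in>Q. x = r \<odot>\<^bsub>P\<^esub> p \<oplus>\<^bsub>P\<^esub> q)" for x r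
  have rep_ex: "\<exists>r. rep x r" if "x \<in> carrier P" for x
    using that unfolding PQ[symmetric] P.mem_set_add by (auto simp: rep_def cyclic_submodule_def)
  have rep_add: "rep (x \<oplus>\<^bsub>P\<^esub> y) (r \<oplus>\<^bsub>R\<^esub> s)" if rs: "rep x r" "rep y s" for x y r s
  proof -
    obtain q q' where q: "q \<in> Q" "q' \<in> Q" "x = r \<odot>\<^bsub>P\<^esub> p \<oplus>\<^bsub>P\<^esub> q" "y = s \<odot>\<^bsub>P\<^esub> p \<oplus>\<^bsub>P\<^esub> q'"
      and c: "r \<in> carrier R" "s \<in> carrier R" using rs by (auto simp: rep_def)
    have qc: "q \<in> carrier P" "q' \<in> carrier P" using q QD(1) by auto
    have "x \<oplus>\<^bsub>P\<^esub> y = (r \<oplus>\<^bsub>R\<^esub> s) \<odot>\<^bsub>P\<^esub> p \<oplus>\<^bsub>P\<^esub> (q \<oplus>\<^bsub>P\<^esub> q')"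
      using q c p qc by (simp add: P.smult_l_distr P.smult_closed P.M.a_ac)
    then show ?thesis using q(1,2) c QD(3) by (auto simp: rep_def)
  qed
  have rep_smult: "rep (s \<odot>\<^bsub>P\<^esub> x) (r \<otimes>\<^bsub>R\<^esub> s)" if rs: "rep x r" "s \<in> carrier R" for x r s
  proof -
    obtain q where q: "q \<in> Q" "x = r \<odot>\<^bsub>P\<^esub> p \<oplus>\<^bsub>P\<^esub> q" and c: "r \<in> carrier R"
      using rs by (auto simp: rep_def)
    then have "s \<odot>\<^bsub>P\<^esub> x = (r \<otimes>\<^bsub>R\<^esub> s) \<odot>\<^bsub>P\<^esub> p \<oplus>\<^bsub>P\<^esub> s \<odot>\<^bsub>P\<^esub> q"
      using rs p QD(1) by (simp add: subset_iff P.smult_assoc P.smult_closed P.smult_r_distr)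
    then show ?thesis using q(1) c rs QD(5) by (auto simp: rep_def)
  qed
  \<comment> \<open>Here the sum must be direct: \<open>p r = -q\<close> lies in
    \<open>p R \<inter> Q = 0\<close>.\<close>
  have rep_zero: "r \<odot>\<^bsub>P\<^esub> p = \<zero>\<^bsub>P\<^esub>" if r: "rep \<zero>\<^bsub>P\<^esub> r" for r
  proof -
    obtain q where q: "q \<in> Q" "\<zero>\<^bsub>P\<^esub> = r \<odot>\<^bsub>P\<^esub> p \<oplus>\<^bsub>P\<^esub> q" and c: "r \<in> carrier R"
      using r by (auto simp: rep_def)
    then have "r \<odot>\<^bsub>P\<^esub> p = \<ominus>\<^bsub>P\<^esub> q"
      using P.M.minus_equality[OF q(2)[symmetric]] P.smult_closed[OF c p] QD(1) by auto
    then have "r \<odot>\<^bsub>P\<^esub> p \<in> Q" using q(1) QD(4) by simp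
    moreover have "r \<odot>\<^bsub>P\<^esub> p \<in> cyclic_submodule R P p" using c by (simp add: cyclic_submodule_def)
    ultimately show ?thesis using disj by blast
  qed
  \<comment> \<open>The difference of two coefficients of \<open>x\<close> is a coefficient of zero,
    so it annihilates \<open>p\<close> and sends \<open>m\<close> into \<open>L\<close>.\<close>
  have rep_unique: "L +>\<^bsub>M\<^esub> (r \<odot>\<^bsub>M\<^esub> m) = L +>\<^bsub>M\<^esub> (s \<odot>\<^bsub>M\<^esub> m)"
    if x: "x \<in> carrier P" and rs: "rep x r" "rep x s" for x r s
  proof -
    have c: "r \<in> carrier R" "s \<in> carrier R" using rs by (auto simp: rep_def)
    have "rep ((\<ominus>\<^bsub>R\<^esub> \<one>\<^bsub>R\<^esub>) \<odot>\<^bsub>P\<^esub> x) (s \<otimes>\<^bsub>R\<^esub> (\<ominus>\<^bsub>R\<^esub> \<one>\<^bsub>R\<^esub>))" using rs by (intro rep_smult) auto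
    moreover have "x \<oplus>\<^bsub>P\<^esub> (\<ominus>\<^bsub>R\<^esub> \<one>\<^bsub>R\<^esub>) \<odot>\<^bsub>P\<^esub> x = \<zero>\<^bsub>P\<^esub>"
      using x by (simp add: P.smult_minus_left P.smult_one P.M.r_neg)
    moreover have "s \<otimes>\<^bsub>R\<^esub> (\<ominus>\<^bsub>R\<^esub> \<one>\<^bsub>R\<^esub>) = \<ominus>\<^bsub>R\<^esub> s" using c by (simp add: P.R.r_minus)
    ultimately have "rep \<zero>\<^bsub>P\<^esub> (r \<oplus>\<^bsub>R\<^esub> (\<ominus>\<^bsub>R\<^esub> s))" using rep_add[OF rs(1)] by metis
    then have "(r \<oplus>\<^bsub>R\<^esub> (\<ominus>\<^bsub>R\<^esub> s)) \<odot>\<^bsub>M\<^esub> m \<in> L" using c by (intro LI rep_zero) auto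
    then have "r \<odot>\<^bsub>M\<^esub> m \<ominus>\<^bsub>M\<^esub> s \<odot>\<^bsub>M\<^esub> m \<in> L"
      using c m by (simp add: a_minus_def M.smult_l_distr M.smult_minus_left)
    then show ?thesis using c m by (simp add: M.quotient_eq_iff[OF L] M.smult_closed)
  qed
  \<comment> \<open>By \<open>rep_unique\<close> any coefficient of \<open>x\<close> yields the same
    coset, so \<open>f\<close> inherits additivity and linearity from \<open>rep_add\<close> and
    \<open>rep_smult\<close>.\<close>
  define f where "f x = L +>\<^bsub>M\<^esub> ((SOME r. rep x r) \<odot>\<^bsub>M\<^esub> m)" for x
  have f: "f x = L +>\<^bsub>M\<^esub> (r \<odot>\<^bsub>M\<^esub> m)" if x: "x \<in> carrier P" and r: "rep x r" for x r
    unfolding f_def using rep_unique[OF x someI[of "rep x", OF r] r] .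
  have rep_closed: "r \<in> carrier R" if "rep x r" for x r using that by (simp add: rep_def)
  have "f \<in> module_homs R P (quotient_module M L)"
    unfolding module_homs_def hom_def
  proof (intro CollectI conjI ballI Pi_I)
    fix x assume x: "x \<in> carrier (add_monoid P)"
    then obtain r where r: "rep x r" using rep_ex by auto
    then show "f x \<in> carrier (add_monoid (quotient_module M L))"
      using x f[of x r] rep_closed[OF r] M.smult_closed m
      by (auto simp: quotient_module_def A_RCOSETS_def')
    fix y assume y: "y \<in> carrier (add_monoid P)"
    then obtain s where s: "rep y s" using rep_ex by auto
    show "f (x \<otimes>\<^bsub>add_monoid P\<^esub> y) = f x \<otimes>\<^bsub>add_monoid (quotient_module M L)\<^esub> f y"
      using x y f[of x r] f[of y s] f[OF _ rep_add[OF r s]] r s rep_closed[OF r] rep_closed[OF s] m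
      by (simp add: quotient_module_def M.quotient_add[OF L] M.smult_closed M.smult_l_distr)
  next
    fix s x assume s: "s \<in> carrier R" and x: "x \<in> carrier P"
    then obtain r where r: "rep x r" using rep_ex by auto
    show "f (s \<odot>\<^bsub>P\<^esub> x) = s \<odot>\<^bsub>quotient_module M L\<^esub> f x"
      using s x m f[OF x r] f[OF _ rep_smult[OF r s]] rep_closed[OF r]
      by (simp add: M.quotient_smult[OF L] M.smult_closed P.smult_closed M.smult_assoc)
  qed
  then obtain h where h: "h \<in> module_homs R P M" "\<forall>x\<in>carrier P. L +>\<^bsub>M\<^esub> h x = f x"
    using proj L unfolding relatively_projective_def by blast
  have hp: "h p \<in> carrier M" using h(1) p by (auto simp: module_homs_def hom_def)
  \<comment> \<open>With coefficient one and \<open>q = 0\<close>, \<open>f p\<close> is the coset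
    of \<open>m\<close>; the lift therefore agrees with \<open>m\<close> at \<open>p\<close> up to
    \<open>L\<close>.\<close>
  have "rep p \<one>\<^bsub>R\<^esub>" using QD(2) p by (auto simp: rep_def P.smult_one intro!: bexI[of _ "\<zero>\<^bsub>P\<^esub>"])
  then have "L +>\<^bsub>M\<^esub> h p = L +>\<^bsub>M\<^esub> m" using h(2) p f[of p "\<one>\<^bsub>R\<^esub>"] m by (simp add: M.smult_one)
  then have "h p \<ominus>\<^bsub>M\<^esub> m \<in> L" using M.quotient_eq_iff[OF L hp m] by simp
  then obtain t where t: "t \<in> carrier R" "t \<odot>\<^bsub>P\<^esub> p = \<zero>\<^bsub>P\<^esub>" "h p \<ominus>\<^bsub>M\<^esub> m = t \<odot>\<^bsub>M\<^esub> m"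
    using LE by blast
  \<comment> \<open>The required scalar is \<open>t + 1\<close>: since \<open>p t = 0\<close> it
    fixes \<open>p\<close>, and it moves \<open>m\<close> by \<open>m t = h p - m\<close> to
    \<open>h p\<close>.\<close>
  have "(t \<oplus>\<^bsub>R\<^esub> \<one>\<^bsub>R\<^esub>) \<odot>\<^bsub>M\<^esub> m = (h p \<ominus>\<^bsub>M\<^esub> m) \<oplus>\<^bsub>M\<^esub> m"
    using t m by (simp add: M.smult_l_distr M.smult_one)
  also have "\<dots> = h p" using hp m by (simp add: a_minus_def M.M.a_assoc M.M.l_neg)
  finally have "(t \<oplus>\<^bsub>R\<^esub> \<one>\<^bsub>R\<^esub>) \<odot>\<^bsub>M\<^esub> m = h p" .
  moreover have "(t \<oplus>\<^bsub>R\<^esub> \<one>\<^bsub>R\<^esub>) \<odot>\<^bsub>P\<^esub> p = p" using t p by (simp add: P.smult_l_distr P.smult_one)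
  ultimately show thesis using that[OF h(1)] t(1) by blast
qed

section \<open>The decomposition of the direct sum\<close>

theorem theorem3p14:
  fixes R :: "('a, 'r) ring_scheme"
    and M1 :: "('a, 'b, 'm) module_scheme"
    and M2 :: "('a, 'c, 'n) module_scheme"
  assumes "ring R"
    and "right_module R M1" and "right_module R M2"
    and "semisimple_module R M1"
    and "principally_delta_lifting R M2"
    and "relatively_projective R M1 M2"
    and "relatively_projective R M2 M1"
  shows "principally_delta_lifting R (direct_sum_module M1 M2)"
proof -
  interpret M1: right_module R M1 by fact
  interpret M2: right_module R M2 by fact
  let ?M = "direct_sum_module M1 M2"
  interpret M: right_module R ?M by (rule direct_sum_right_module) fact+
  have Mc: "carrier ?M = carrier M1 \<times> carrier M2"
    and M0: "\<zero>\<^bsub>?M\<^esub> = (\<zero>\<^bsub>M1\<^esub>, \<zero>\<^bsub>M2\<^esub>)"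
    and Ma: "\<And>x y x' y'. (x, y) \<oplus>\<^bsub>?M\<^esub> (x', y') = (x \<oplus>\<^bsub>M1\<^esub> x', y \<oplus>\<^bsub>M2\<^esub> y')"
    and Ms: "\<And>r x y. r \<odot>\<^bsub>?M\<^esub> (x, y) = (r \<odot>\<^bsub>M1\<^esub> x, r \<odot>\<^bsub>M2\<^esub> y)"
    by (auto simp: direct_sum_module_def)
  have "\<exists>A B. internal_direct_sum R ?M A B \<and> A \<subseteq> cyclic_submodule R ?M m \<and>
      delta_small R (?M\<lparr>carrier := B\<rparr>) (cyclic_submodule R ?M m \<inter> B)"
    if m: "m \<in> carrier ?M" for m
  proof -
    obtain m1 m2 where mm: "m = (m1, m2)" and m1: "m1 \<in> carrier M1" and m2: "m2 \<in> carrier M2"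
      using m by (auto simp: Mc)
    let ?K = "cyclic_submodule R M1 m1"
    have K: "submodule ?K R M1" by (rule M1.submodule_cyclic[OF m1])
    obtain K' where KK': "internal_direct_sum R M1 ?K K'"
      using M1.semisimple_complement[OF assms(4) K] .
    \<comment> \<open>The equations for \<open>r\<close> say \<open>m r = (m1, h m1)\<close>: the
      generator of the graph of \<open>h\<close> over \<open>m1 R\<close> belongs to
      \<open>m R\<close>.\<close>
    obtain h r where h: "h \<in> module_homs R M1 M2" and r: "r \<in> carrier R"
        "r \<odot>\<^bsub>M1\<^esub> m1 = m1" "r \<odot>\<^bsub>M2\<^esub> m2 = h m1"
      using relatively_projective_cyclic_graph[OF assms(2,3,6) m1 m2 KK'] .
    have hc: "h x \<in> carrier M2" if "x \<in> carrier M1" for x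
      using h that by (auto simp: module_homs_def hom_def)
    have ha: "h (x \<oplus>\<^bsub>M1\<^esub> y) = h x \<oplus>\<^bsub>M2\<^esub> h y" if "x \<in> carrier M1" "y \<in> carrier M1" for x y
      using h that by (auto simp: module_homs_def hom_def)
    have hs: "h (s \<odot>\<^bsub>M1\<^esub> x) = s \<odot>\<^bsub>M2\<^esub> h x" if "s \<in> carrier R" "x \<in> carrier M1" for s x
      using h that by (auto simp: module_homs_def)
    have h0: "h \<zero>\<^bsub>M1\<^esub> = \<zero>\<^bsub>M2\<^esub>"
      using hs[of "\<zero>\<^bsub>R\<^esub>" "\<zero>\<^bsub>M1\<^esub>"] hc by (simp add: M1.smult_zero_left M2.smult_zero_left)
    \<comment> \<open>This is the second coordinate of \<open>m - m r = (0, n)\<close>, which is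
      again an element of \<open>m R\<close>.\<close>
    define n where "n = m2 \<ominus>\<^bsub>M2\<^esub> h m1"
    have n: "n \<in> carrier M2" using m1 m2 hc by (simp add: n_def)
    let ?N = "cyclic_submodule R M2 n"
    obtain A B where AB: "internal_direct_sum R M2 A B" and AN: "A \<subseteq> ?N"
        and small: "delta_small R (M2\<lparr>carrier := B\<rparr>) (?N \<inter> B)"
      using assms(5) n unfolding principally_delta_lifting_def by blast
    have K': "submodule K' R M1" and K'sum: "?K <+>\<^bsub>M1\<^esub> K' = carrier M1"
      and K'int: "?K \<inter> K' = {\<zero>\<^bsub>M1\<^esub>}" using KK' by (auto simp: internal_direct_sum_def)
    have A: "submodule A R M2" and B: "submodule B R M2" and ABsum: "A <+>\<^bsub>M2\<^esub> B = carrier M2"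
      and ABint: "A \<inter> B = {\<zero>\<^bsub>M2\<^esub>}" using AB by (auto simp: internal_direct_sum_def)
    note KD = M1.submoduleD[OF K] and K'D = M1.submoduleD[OF K']
      and AD = M2.submoduleD[OF A] and BD = M2.submoduleD[OF B]
    \<comment> \<open>The image of \<open>m1 R \<times> A\<close> under the shear
      \<open>(k, a) \<mapsto> (k, h k + a)\<close>, that is, the graph of \<open>h\<close> over
      \<open>m1 R\<close> plus \<open>0 \<times> A\<close>.\<close>
    define A' where "A' = (\<lambda>(k, a). (k, h k \<oplus>\<^bsub>M2\<^esub> a)) ` (?K \<times> A)"
    have A'I: "(k, h k \<oplus>\<^bsub>M2\<^esub> a) \<in> A'" if "k \<in> ?K" "a \<in> A" for k a
      using that by (auto simp: A'_def)
    have A'E: "\<exists>k\<in>?K. \<exists>a\<in>A. x = (k, h k \<oplus>\<^bsub>M2\<^esub> a)" if "x \<in> A'" for x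
      using that by (auto simp: A'_def)
    have A': "submodule A' R ?M"
    proof (rule M.submoduleI)
      show "A' \<subseteq> carrier ?M" using KD(1) AD(1) hc by (force simp: A'_def Mc)
      show "\<zero>\<^bsub>?M\<^esub> \<in> A'" using A'I[OF KD(2) AD(2)] by (simp add: h0 M0)
      fix x assume "x \<in> A'"
      then obtain k a where x: "k \<in> ?K" "a \<in> A" "x = (k, h k \<oplus>\<^bsub>M2\<^esub> a)" using A'E by blast
      have xc: "k \<in> carrier M1" "a \<in> carrier M2" using x KD(1) AD(1) by auto
      show "s \<odot>\<^bsub>?M\<^esub> x \<in> A'" if s: "s \<in> carrier R" for s
        using A'I[OF KD(5)[OF s x(1)] AD(5)[OF s x(2)]] x(3) xc s hc
        by (simp add: Ms hs M2.smult_r_distr)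
      fix y assume "y \<in> A'"
      then obtain k' a' where y: "k' \<in> ?K" "a' \<in> A" "y = (k', h k' \<oplus>\<^bsub>M2\<^esub> a')" using A'E by blast
      have yc: "k' \<in> carrier M1" "a' \<in> carrier M2" using y KD(1) AD(1) by auto
      show "x \<oplus>\<^bsub>?M\<^esub> y \<in> A'"
        using A'I[OF KD(3)[OF x(1) y(1)] AD(3)[OF x(2) y(2)]] x(3) y(3) xc yc hc
        by (simp add: Ma ha M2.M.a_ac)
    qed
    have B': "submodule (K' \<times> B) R ?M"
      by (rule M.submoduleI) (use K'D BD in \<open>auto simp: Mc M0 Ma Ms\<close>)
    \<comment> \<open>First split \<open>x = k + k'\<close>, then split the corrected coordinate
      \<open>y - h k\<close> along \<open>A\<close> and \<open>B\<close>; the correction compensates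
      for the shear.\<close>
    have "carrier ?M \<subseteq> A' <+>\<^bsub>?M\<^esub> (K' \<times> B)"
    proof
      fix z assume "z \<in> carrier ?M"
      then obtain x y where z: "z = (x, y)" "x \<in> carrier M1" "y \<in> carrier M2" by (auto simp: Mc)
      then obtain k k' where k: "k \<in> ?K" "k' \<in> K'" "x = k \<oplus>\<^bsub>M1\<^esub> k'"
        unfolding K'sum[symmetric] M1.mem_set_add by blast
      have kc: "k \<in> carrier M1" using k KD(1) by auto
      then have "\<ominus>\<^bsub>M2\<^esub> h k \<oplus>\<^bsub>M2\<^esub> y \<in> carrier M2" using hc z by simp
      then obtain a b where ab: "a \<in> A" "b \<in> B" "\<ominus>\<^bsub>M2\<^esub> h k \<oplus>\<^bsub>M2\<^esub> y = a \<oplus>\<^bsub>M2\<^esub> b"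
        unfolding ABsum[symmetric] M2.mem_set_add by blast
      have abc: "a \<in> carrier M2" "b \<in> carrier M2" using ab AD(1) BD(1) by auto
      have "y = h k \<oplus>\<^bsub>M2\<^esub> (\<ominus>\<^bsub>M2\<^esub> h k \<oplus>\<^bsub>M2\<^esub> y)" using hc[OF kc] z by (simp add: M2.M.r_neg2)
      then have "y = (h k \<oplus>\<^bsub>M2\<^esub> a) \<oplus>\<^bsub>M2\<^esub> b"
        using ab(3) abc hc[OF kc] by (simp add: M2.M.a_assoc)
      then have "z = (k, h k \<oplus>\<^bsub>M2\<^esub> a) \<oplus>\<^bsub>?M\<^esub> (k', b)" using z(1) k(3) by (simp add: Ma)
      then show "z \<in> A' <+>\<^bsub>?M\<^esub> (K' \<times> B)"
        unfolding M.mem_set_add using A'I[OF k(1) ab(1)] k(2) ab(2) by blast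
    qed
    \<comment> \<open>The first coordinate lies in \<open>m1 R \<inter> K' = 0\<close>, so the shear
      vanishes there and the second coordinate lies in \<open>A \<inter> B = 0\<close>.\<close>
    moreover have "A' \<inter> (K' \<times> B) \<subseteq> {\<zero>\<^bsub>?M\<^esub>}"
    proof
      fix z assume z: "z \<in> A' \<inter> (K' \<times> B)"
      then obtain k a where ka: "k \<in> ?K" "a \<in> A" "z = (k, h k \<oplus>\<^bsub>M2\<^esub> a)" using A'E by blast
      then have k0: "k = \<zero>\<^bsub>M1\<^esub>" using z K'int by blast
      then have "a \<in> B" using z ka AD(1) by (auto simp: h0)
      then have "a = \<zero>\<^bsub>M2\<^esub>" using ka(2) ABint by blast
      then show "z \<in> {\<zero>\<^bsub>?M\<^esub>}" using ka(3) k0 by (simp add: M0 h0)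
    qed
    ultimately have "internal_direct_sum R ?M A' (K' \<times> B)"
      using A' B' M.submoduleD(1)[OF M.submodule_sum[OF A' B']]
        M.submoduleD(2)[OF A'] M.submoduleD(2)[OF B']
      unfolding internal_direct_sum_def by blast
    \<comment> \<open>Graph points plus multiples of \<open>(0, n)\<close> stay in
      \<open>m R\<close>. With \<open>n t \<in> A\<close> this yields
      \<open>A' \<subseteq> m R\<close>; with \<open>s = 0\<close> it puts
      \<open>0 \<times> n R\<close> into \<open>m R\<close>.\<close>
    moreover have cyc: "(s \<odot>\<^bsub>M1\<^esub> m1, s \<odot>\<^bsub>M2\<^esub> h m1 \<oplus>\<^bsub>M2\<^esub> t \<odot>\<^bsub>M2\<^esub> n) \<in> cyclic_submodule R ?M m"
      if s: "s \<in> carrier R" and t: "t \<in> carrier R" for s t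
    proof -
      \<comment> \<open>Scalars act from the right, so \<open>m u = (m r) s + (m (1 - r)) t\<close>,
        where \<open>m r = (m1, h m1)\<close> and \<open>m (1 - r) = (0, n)\<close>.\<close>
      define u where "u = r \<otimes>\<^bsub>R\<^esub> s \<oplus>\<^bsub>R\<^esub> (\<one>\<^bsub>R\<^esub> \<oplus>\<^bsub>R\<^esub> \<ominus>\<^bsub>R\<^esub> r) \<otimes>\<^bsub>R\<^esub> t"
      have "u \<odot>\<^bsub>M1\<^esub> m1 = s \<odot>\<^bsub>M1\<^esub> m1"
        using r s t m1 by (simp add: u_def M1.smult_l_distr M1.smult_assoc M1.smult_one
          M1.smult_minus_left M1.M.r_neg M1.smult_zero_right M1.smult_closed)
      moreover have "u \<odot>\<^bsub>M2\<^esub> m2 = s \<odot>\<^bsub>M2\<^esub> h m1 \<oplus>\<^bsub>M2\<^esub> t \<odot>\<^bsub>M2\<^esub> n"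
        using r s t m2 by (simp add: u_def n_def a_minus_def M2.smult_l_distr M2.smult_assoc
          M2.smult_one M2.smult_minus_left)
      moreover have "u \<in> carrier R" using r s t by (simp add: u_def)
      ultimately show ?thesis unfolding cyclic_submodule_def mm by (metis Ms imageI)
    qed
    have "A' \<subseteq> cyclic_submodule R ?M m"
    proof
      fix z assume "z \<in> A'"
      then obtain k a where ka: "k \<in> ?K" "a \<in> A" "z = (k, h k \<oplus>\<^bsub>M2\<^esub> a)" using A'E by blast
      then obtain s t where "s \<in> carrier R" "k = s \<odot>\<^bsub>M1\<^esub> m1" "t \<in> carrier R" "a = t \<odot>\<^bsub>M2\<^esub> n"
        using AN by (auto simp: cyclic_submodule_def)
      then show "z \<in> cyclic_submodule R ?M m" using cyc ka(3) m1 by (simp add: hs)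
    qed
    \<comment> \<open>If \<open>m s \<in> K' \<times> B\<close>, then
      \<open>m1 s \<in> m1 R \<inter> K' = 0\<close>. Applying \<open>h\<close> gives
      \<open>(h m1) s = 0\<close>, hence \<open>m2 s = n s\<close>. The converse inclusion is
      \<open>cyc\<close> with zero as first scalar.\<close>
    moreover have "cyclic_submodule R ?M m \<inter> (K' \<times> B) = Pair \<zero>\<^bsub>M1\<^esub> ` (?N \<inter> B)"
    proof (intro equalityI subsetI)
      fix z assume z: "z \<in> cyclic_submodule R ?M m \<inter> (K' \<times> B)"
      then obtain s where s: "s \<in> carrier R" "z = (s \<odot>\<^bsub>M1\<^esub> m1, s \<odot>\<^bsub>M2\<^esub> m2)"
        by (auto simp: cyclic_submodule_def mm Ms)
      then have s0: "s \<odot>\<^bsub>M1\<^esub> m1 = \<zero>\<^bsub>M1\<^esub>" using z K'int by (auto simp: cyclic_submodule_def)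
      then have "s \<odot>\<^bsub>M2\<^esub> h m1 = \<zero>\<^bsub>M2\<^esub>" using hs[OF s(1) m1] h0 by simp
      then have "s \<odot>\<^bsub>M2\<^esub> n = s \<odot>\<^bsub>M2\<^esub> m2"
        using s m1 m2 hc by (simp add: n_def a_minus_def M2.smult_r_distr M2.smult_minus_right
          M2.smult_closed)
      then have "s \<odot>\<^bsub>M2\<^esub> m2 \<in> ?N" using s(1) by (metis cyclic_submodule_def imageI)
      then show "z \<in> Pair \<zero>\<^bsub>M1\<^esub> ` (?N \<inter> B)" using z s s0 by auto
    next
      fix z assume "z \<in> Pair \<zero>\<^bsub>M1\<^esub> ` (?N \<inter> B)"
      then obtain t where t: "t \<in> carrier R" "t \<odot>\<^bsub>M2\<^esub> n \<in> B" "z = (\<zero>\<^bsub>M1\<^esub>, t \<odot>\<^bsub>M2\<^esub> n)"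
        by (auto simp: cyclic_submodule_def)
      then show "z \<in> cyclic_submodule R ?M m \<inter> (K' \<times> B)"
        using cyc[of "\<zero>\<^bsub>R\<^esub>" t] K'D(2) m1 n hc
        by (simp add: M1.smult_zero_left M2.smult_zero_left M2.smult_closed)
    qed
    \<comment> \<open>The embedding \<open>y \<mapsto> (0, y)\<close> of \<open>B\<close> into
      \<open>K' \<times> B\<close> transports the smallness of
      \<open>n R \<inter> B\<close>.\<close>
    moreover have "delta_small R (?M\<lparr>carrier := K' \<times> B\<rparr>) (Pair \<zero>\<^bsub>M1\<^esub> ` (?N \<inter> B))"
    proof (rule delta_small_image[OF M2.submodule_right_module[OF B]
          M.submodule_right_module[OF B'] _ small])
      show "Pair \<zero>\<^bsub>M1\<^esub> \<in> module_homs R (M2\<lparr>carrier := B\<rparr>) (?M\<lparr>carrier := K' \<times> B\<rparr>)"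
        using K'D(2) by (auto simp: module_homs_def hom_def Ma Ms M1.smult_zero_right)
    qed
    ultimately show ?thesis by metis
  qed
  then show ?thesis by (simp add: principally_delta_lifting_def)
qed

end
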